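(* Let $M$ be a manifold and $U$ a fixed vector field on $M$. Consider the set of quadruples $(\circ,e,\mathcal{E},\tilde{\nabla})$, where $\circ$ is the multiplication of an $F$-manifold structure on $M$ with unit field $e$, $\mathcal{E}$ is an eventual identity on $(M,\circ,e)$, and $\tilde{\nabla}$ is a torsion-free connection on $TM$, compatible with $\circ$, such that $$\tilde{\nabla}_{X}(e)=U\circ X,\qquad\forall X\in\mathcal{X}(M).$$ Then the map $$(\circ,e,\mathcal{E},\tilde{\nabla})\rightarrow( *,\mathcal{E},e,\nabla),$$ where $X*Y:=X\circ Y\circ\mathcal{E}^{-1}$ and $$\nabla_{X}(Y)=\mathcal{E}\circ\tilde{\nabla}_{X}(\mathcal{E}^{-1}\circ Y)-\tilde{\nabla}_{\mathcal{E}^{-1}\circ Y}(\mathcal{E})\circ X+\frac{1}{2}[\mathcal{E}^{-1},\mathcal{E}]\circ X\circ Y+U*X*Y,$$ is an involution on this set of quadruples.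
   Context: Everything is in the smooth category; $\mathcal{X}(M)$ denotes the vector fields on the manifold $M$. $F$-manifold: a triple $(M,\circ,e)$ where $M$ is a manifold and $\circ$ is a fiber-preserving commutative, associative, bilinear multiplication on $TM$ with unit field $e$, such that $L_{X\circ Y}(\circ)=X\circ L_{Y}(\circ)+Y\circ L_{X}(\circ)$ for all $X,Y\in\mathcal{X}(M)$, where $L_{Z}(\circ)(X,Y)=[Z,X\circ Y]-[Z,X]\circ Y-X\circ[Z,Y]$. Invertible vector field: $\mathcal{E}$ is invertible if there is a vector field $\mathcal{E}^{-1}$ with $\mathcal{E}\circ\mathcal{E}^{-1}=e$. Eventual identity on an $F$-manifold $(M,\circ,e)$: an invertible vector field $\mathcal{E}$ such that the multiplication $X*Y:=X\circ Y\circ\mathcal{E}^{-1}$ (whose unit field is $\mathcal{E}$) defines an $F$-manifold $(M,*,\mathcal{E})$. It is known that then $e$ is an eventual identity on $(M,*,\mathcal{E})$ and that $(M,\circ,e,\mathcal{E})\mapsto(M,*,\mathcal{E},e)$ is an involution on the set of $F$-manifolds with eventual identities. Compatible connection: a connection $\nabla$ on $TM$ is compatible with a commutative, associative multiplication $\circ$ on $TM$ if $\nabla_{X}(\circ)(Y,Z):=\nabla_{X}(Y\circ Z)-\nabla_{X}(Y)\circ Z-Y\circ\nabla_{X}(Z)$ is totally symmetric in $X,Y,Z$. *)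

theory Defs
  imports "HOL-Analysis.Analysis" "HOL-Library.Function_Algebras"
begin

text \<open>Conventions. Manifolds are smooth, Hausdorff and second countable, of a fixed dimension
  \<open>n \<ge> 0\<close>, given by an atlas. A tangent vector at \<open>p\<close> is a derivation at \<open>p\<close> of the algebra of
  smooth functions; a vector field is smooth when it maps smooth functions to smooth functions.
  Functions, vector fields, multiplications and connections are \<open>0\<close> outside their domains, so that
  equality in HOL is equality of the mathematical objects. Sums and differences of functions,
  tangent vectors and vector fields are pointwise.\<close>

section \<open>Smooth functions and smooth manifolds\<close>

definition partial_deriv :: "nat \<Rightarrow> ((nat \<Rightarrow> real) \<Rightarrow> real) \<Rightarrow> (nat \<Rightarrow> real) \<Rightarrow> real" where
  "partial_deriv i f x = deriv (\<lambda>t. f (x(i := t))) (x i)"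

text \<open>Class \<open>C\<^sup>k\<close> on an open subset \<open>S\<close> of \<^term>\<open>Euclidean_space n\<close>: all partial derivatives
  of order at most \<open>k\<close> exist and are continuous.\<close>

primrec Ck_on :: "nat \<Rightarrow> nat \<Rightarrow> (nat \<Rightarrow> real) set \<Rightarrow> ((nat \<Rightarrow> real) \<Rightarrow> real) \<Rightarrow> bool" where
  "Ck_on n 0 S f \<longleftrightarrow> continuous_on S f"
| "Ck_on n (Suc k) S f \<longleftrightarrow> continuous_on S f \<and>
     (\<forall>i<n. (\<forall>x\<in>S. (\<lambda>t. f (x(i := t))) field_differentiable at (x i)) \<and>
            Ck_on n k S (partial_deriv i f))"

definition smooth_on :: "nat \<Rightarrow> (nat \<Rightarrow> real) set \<Rightarrow> ((nat \<Rightarrow> real) \<Rightarrow> real) \<Rightarrow> bool" where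
  "smooth_on n S f \<longleftrightarrow> (\<forall>k. Ck_on n k S f)"

record 'p manifold_data =
  mdim :: nat
  mtop :: "'p topology"
  atlas :: "('p set \<times> ('p \<Rightarrow> nat \<Rightarrow> real)) set"

abbreviation points :: "'p manifold_data \<Rightarrow> 'p set" where
  "points M \<equiv> topspace (mtop M)"

definition is_chart :: "'p manifold_data \<Rightarrow> 'p set \<Rightarrow> ('p \<Rightarrow> nat \<Rightarrow> real) \<Rightarrow> bool" where
  "is_chart M V \<phi> \<longleftrightarrow> openin (mtop M) V \<and> openin (Euclidean_space (mdim M)) (\<phi> ` V) \<and>
     homeomorphic_map (subtopology (mtop M) V) (subtopology (Euclidean_space (mdim M)) (\<phi> ` V)) \<phi>"

definition smooth_manifold :: "'p manifold_data \<Rightarrow> bool" where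
  "smooth_manifold M \<longleftrightarrow>
     Hausdorff_space (mtop M) \<and> second_countable (mtop M) \<and>
     (\<Union>(V, \<phi>)\<in>atlas M. V) = points M \<and>
     (\<forall>(V, \<phi>)\<in>atlas M. is_chart M V \<phi>) \<and>
     (\<forall>(V, \<phi>)\<in>atlas M. \<forall>(W, \<psi>)\<in>atlas M. \<forall>i<mdim M.
        smooth_on (mdim M) (\<phi> ` (V \<inter> W)) (\<lambda>x. \<psi> (inv_into V \<phi> x) i))"

definition smooth_functions :: "'p manifold_data \<Rightarrow> ('p \<Rightarrow> real) set" where
  "smooth_functions M = {f. (\<forall>p. p \<notin> points M \<longrightarrow> f p = 0) \<and>
     (\<forall>(V, \<phi>)\<in>atlas M. smooth_on (mdim M) (\<phi> ` V) (\<lambda>x. f (inv_into V \<phi> x)))}"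

section \<open>Tangent vectors and vector fields\<close>

type_synonym 'p tvec = "('p \<Rightarrow> real) \<Rightarrow> real"
type_synonym 'p vfield = "'p \<Rightarrow> 'p tvec"

definition tangent_space :: "'p manifold_data \<Rightarrow> 'p \<Rightarrow> 'p tvec set" where
  "tangent_space M p = {v.
     (\<forall>f. f \<notin> smooth_functions M \<longrightarrow> v f = 0) \<and>
     (\<forall>f\<in>smooth_functions M. \<forall>g\<in>smooth_functions M. v (f + g) = v f + v g) \<and>
     (\<forall>f\<in>smooth_functions M. \<forall>c::real. v (\<lambda>q. c * f q) = c * v f) \<and>
     (\<forall>f\<in>smooth_functions M. \<forall>g\<in>smooth_functions M. v (f * g) = v f * g p + f p * v g)}"

definition vector_fields :: "'p manifold_data \<Rightarrow> 'p vfield set" where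
  "vector_fields M = {X.
     (\<forall>p\<in>points M. X p \<in> tangent_space M p) \<and> (\<forall>p. p \<notin> points M \<longrightarrow> X p = 0) \<and>
     (\<forall>f\<in>smooth_functions M. (\<lambda>p. X p f) \<in> smooth_functions M)}"

definition apply_vf :: "'p vfield \<Rightarrow> ('p \<Rightarrow> real) \<Rightarrow> 'p \<Rightarrow> real" where
  "apply_vf X f = (\<lambda>p. X p f)"

definition scale_vf :: "('p \<Rightarrow> real) \<Rightarrow> 'p vfield \<Rightarrow> 'p vfield" where
  "scale_vf f X = (\<lambda>p g. f p * X p g)"

definition lie_bracket :: "'p vfield \<Rightarrow> 'p vfield \<Rightarrow> 'p vfield" where
  "lie_bracket X Y = (\<lambda>p f. X p (apply_vf Y f) - Y p (apply_vf X f))"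

section \<open>Multiplications on the tangent bundle\<close>

type_synonym 'p tmult = "'p \<Rightarrow> 'p tvec \<Rightarrow> 'p tvec \<Rightarrow> 'p tvec"

definition vf_mult :: "'p vfield \<Rightarrow> 'p tmult \<Rightarrow> 'p vfield \<Rightarrow> 'p vfield"
    ("(_ \<odot>\<^bsub>_\<^esub> _)" [70, 0, 71] 70) where
  "X \<odot>\<^bsub>m\<^esub> Y = (\<lambda>p. m p (X p) (Y p))"

text \<open>Smooth, fibre-preserving, commutative, associative and bilinear. Linearity in the second
  argument follows from commutativity.\<close>

definition tangent_multiplication :: "'p manifold_data \<Rightarrow> 'p tmult \<Rightarrow> bool" where
  "tangent_multiplication M m \<longleftrightarrow>
     (\<forall>p\<in>points M. \<forall>v\<in>tangent_space M p. \<forall>w\<in>tangent_space M p.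
        m p v w \<in> tangent_space M p \<and>
        m p v w = m p w v \<and>
        (\<forall>u\<in>tangent_space M p. m p (m p u v) w = m p u (m p v w)) \<and>
        (\<forall>u\<in>tangent_space M p. m p (u + v) w = m p u w + m p v w) \<and>
        (\<forall>c::real. m p (\<lambda>f. c * v f) w = (\<lambda>f. c * m p v w f))) \<and>
     (\<forall>X\<in>vector_fields M. \<forall>Y\<in>vector_fields M. X \<odot>\<^bsub>m\<^esub> Y \<in> vector_fields M) \<and>
     (\<forall>p v w. \<not> (p \<in> points M \<and> v \<in> tangent_space M p \<and> w \<in> tangent_space M p)
        \<longrightarrow> m p v w = 0)"

definition lie_deriv_mult :: "'p tmult \<Rightarrow> 'p vfield \<Rightarrow> 'p vfield \<Rightarrow> 'p vfield \<Rightarrow> 'p vfield" where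
  "lie_deriv_mult m Z X Y =
     lie_bracket Z (X \<odot>\<^bsub>m\<^esub> Y) - lie_bracket Z X \<odot>\<^bsub>m\<^esub> Y - X \<odot>\<^bsub>m\<^esub> lie_bracket Z Y"

definition F_manifold :: "'p manifold_data \<Rightarrow> 'p tmult \<Rightarrow> 'p vfield \<Rightarrow> bool" where
  "F_manifold M m e \<longleftrightarrow>
     smooth_manifold M \<and> tangent_multiplication M m \<and>
     e \<in> vector_fields M \<and> (\<forall>p\<in>points M. \<forall>v\<in>tangent_space M p. m p (e p) v = v) \<and>
     (\<forall>X\<in>vector_fields M. \<forall>Y\<in>vector_fields M. \<forall>Z\<in>vector_fields M. \<forall>W\<in>vector_fields M.
        lie_deriv_mult m (X \<odot>\<^bsub>m\<^esub> Y) Z W =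
          X \<odot>\<^bsub>m\<^esub> lie_deriv_mult m Y Z W + Y \<odot>\<^bsub>m\<^esub> lie_deriv_mult m X Z W)"

definition vf_invertible :: "'p manifold_data \<Rightarrow> 'p tmult \<Rightarrow> 'p vfield \<Rightarrow> 'p vfield \<Rightarrow> bool" where
  "vf_invertible M m e E \<longleftrightarrow> (\<exists>F\<in>vector_fields M. E \<odot>\<^bsub>m\<^esub> F = e)"

text \<open>The inverse is unique whenever it exists, \<open>m\<close> being associative with unit field \<open>e\<close>.\<close>

definition vf_inverse :: "'p manifold_data \<Rightarrow> 'p tmult \<Rightarrow> 'p vfield \<Rightarrow> 'p vfield \<Rightarrow> 'p vfield" where
  "vf_inverse M m e E = (THE F. F \<in> vector_fields M \<and> E \<odot>\<^bsub>m\<^esub> F = e)"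

definition dual_mult :: "'p manifold_data \<Rightarrow> 'p tmult \<Rightarrow> 'p vfield \<Rightarrow> 'p vfield \<Rightarrow> 'p tmult" where
  "dual_mult M m e E = (\<lambda>p v w. m p (m p v w) (vf_inverse M m e E p))"

definition eventual_identity ::
    "'p manifold_data \<Rightarrow> 'p tmult \<Rightarrow> 'p vfield \<Rightarrow> 'p vfield \<Rightarrow> bool" where
  "eventual_identity M m e E \<longleftrightarrow>
     E \<in> vector_fields M \<and> vf_invertible M m e E \<and> F_manifold M (dual_mult M m e E) E"

section \<open>Connections\<close>

type_synonym 'p conn = "'p vfield \<Rightarrow> 'p vfield \<Rightarrow> 'p vfield"

definition connection :: "'p manifold_data \<Rightarrow> 'p conn \<Rightarrow> bool" where
  "connection M D \<longleftrightarrow>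
     (\<forall>X\<in>vector_fields M. \<forall>Y\<in>vector_fields M.
        D X Y \<in> vector_fields M \<and>
        (\<forall>X'\<in>vector_fields M. D (X + X') Y = D X Y + D X' Y) \<and>
        (\<forall>f\<in>smooth_functions M. D (scale_vf f X) Y = scale_vf f (D X Y)) \<and>
        (\<forall>Y'\<in>vector_fields M. D X (Y + Y') = D X Y + D X Y') \<and>
        (\<forall>c::real. D X (scale_vf (\<lambda>_. c) Y) = scale_vf (\<lambda>_. c) (D X Y)) \<and>
        (\<forall>f\<in>smooth_functions M.
           D X (scale_vf f Y) = scale_vf (apply_vf X f) Y + scale_vf f (D X Y))) \<and>
     (\<forall>X Y. \<not> (X \<in> vector_fields M \<and> Y \<in> vector_fields M) \<longrightarrow> D X Y = 0)"

definition torsion_free :: "'p manifold_data \<Rightarrow> 'p conn \<Rightarrow> bool" where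
  "torsion_free M D \<longleftrightarrow> (\<forall>X\<in>vector_fields M. \<forall>Y\<in>vector_fields M. D X Y - D Y X = lie_bracket X Y)"

definition cov_deriv_mult ::
    "'p conn \<Rightarrow> 'p tmult \<Rightarrow> 'p vfield \<Rightarrow> 'p vfield \<Rightarrow> 'p vfield \<Rightarrow> 'p vfield" where
  "cov_deriv_mult D m X Y Z = D X (Y \<odot>\<^bsub>m\<^esub> Z) - D X Y \<odot>\<^bsub>m\<^esub> Z - Y \<odot>\<^bsub>m\<^esub> D X Z"

text \<open>Total symmetry, expressed through two transpositions generating all permutations.\<close>

definition compatible :: "'p manifold_data \<Rightarrow> 'p conn \<Rightarrow> 'p tmult \<Rightarrow> bool" where
  "compatible M D m \<longleftrightarrow>
     (\<forall>X\<in>vector_fields M. \<forall>Y\<in>vector_fields M. \<forall>Z\<in>vector_fields M.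
        cov_deriv_mult D m X Y Z = cov_deriv_mult D m Y X Z \<and>
        cov_deriv_mult D m X Y Z = cov_deriv_mult D m X Z Y)"

section \<open>The quadruples and the duality map\<close>

type_synonym 'p quadruple = "'p tmult \<times> 'p vfield \<times> 'p vfield \<times> 'p conn"

definition quadruples :: "'p manifold_data \<Rightarrow> 'p vfield \<Rightarrow> 'p quadruple set" where
  "quadruples M U = {(m, e, E, D).
     F_manifold M m e \<and> eventual_identity M m e E \<and>
     connection M D \<and> torsion_free M D \<and> compatible M D m \<and>
     (\<forall>X\<in>vector_fields M. D X e = U \<odot>\<^bsub>m\<^esub> X)}"

definition dual_connection ::
    "'p manifold_data \<Rightarrow> 'p vfield \<Rightarrow> 'p tmult \<Rightarrow> 'p vfield \<Rightarrow> 'p vfield \<Rightarrow> 'p conn \<Rightarrow> 'p conn" where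
  "dual_connection M U m e E D = (\<lambda>X Y.
     if X \<in> vector_fields M \<and> Y \<in> vector_fields M then
       (let F = vf_inverse M m e E; s = dual_mult M m e E in
          E \<odot>\<^bsub>m\<^esub> D X (F \<odot>\<^bsub>m\<^esub> Y) - D (F \<odot>\<^bsub>m\<^esub> Y) E \<odot>\<^bsub>m\<^esub> X
          + scale_vf (\<lambda>_. 1/2) (lie_bracket F E \<odot>\<^bsub>m\<^esub> X \<odot>\<^bsub>m\<^esub> Y)
          + U \<odot>\<^bsub>s\<^esub> X \<odot>\<^bsub>s\<^esub> Y)
     else 0)"

definition duality_map :: "'p manifold_data \<Rightarrow> 'p vfield \<Rightarrow> 'p quadruple \<Rightarrow> 'p quadruple" where
  "duality_map M U = (\<lambda>(m, e, E, D).
     (dual_mult M m e E, E, e, dual_connection M U m e E D))"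

definition involution_on :: "'a set \<Rightarrow> ('a \<Rightarrow> 'a) \<Rightarrow> bool" where
  "involution_on A f \<longleftrightarrow> (\<forall>x\<in>A. f x \<in> A \<and> f (f x) = x)"

end

(* Write F for the inverse of E, juxtaposition for the multiplication, and C(X,Y,Z) for the covariant
   derivative of the multiplication. The F-manifold identity of the dual multiplication at the unit E
   says that E acts on it by derivations, which gives
     [E,XY] = [E,X]Y + X[E,Y] - [E,e]XY   and hence   [E,F] = 2F[E,e].
   With these two formulas torsion-freeness and compatibility of the dual connection follow from the
   symmetry of C after the substitution X = Ex, Y = Ey, Z = Ez. The double dual is the
   original connection by C(Y,F,E) = C(F,Y,E) and the formula for [F,EY], which the original
   F-manifold identity yields from the one for [E,EY], since EF = e. *)

theory Submission
  imports Defs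
begin

section \<open>Calculus in charts and the algebra of smooth functions\<close>

lemma eventually_fun_upd_in:
  assumes "openin (Euclidean_space n) S" "x \<in> S" "i < n"
  shows "\<forall>\<^sub>F t in nhds (x i). x(i := t) \<in> S"
proof -
  \<comment> \<open>\<open>S\<close> is the trace of a product-open \<open>T\<close> on the subspace
    where all coordinates from \<open>n\<close> on vanish. Changing a coordinate
    \<open>i < n\<close> stays in that subspace, so only \<open>T\<close> has to be
    controlled.\<close>
  from assms(1) obtain T where T: "open T" "S = T \<inter> {x. \<forall>i\<ge>n. x i = 0}"
    by (auto simp: Euclidean_space_def openin_subtopology euclidean_product_topology)
  have "continuous_on UNIV (\<lambda>t. x(i := t))"
  proof (rule continuous_on_coordinatewise_then_product)
    show "continuous_on UNIV (\<lambda>t. (x(i := t)) j)" for j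
      by (cases "j = i") auto
  qed
  then have "open ((\<lambda>t. x(i := t)) -` T)"
    using T(1) by (simp add: continuous_on_open_vimage)
  moreover have "x i \<in> (\<lambda>t. x(i := t)) -` T"
    using assms(2) T(2) by simp
  ultimately have "\<forall>\<^sub>F t in nhds (x i). x(i := t) \<in> T"
    by (auto simp: eventually_nhds)
  then show ?thesis
    by eventually_elim (use assms T(2) in auto)
qed

text \<open>A partial derivative at a point of \<open>S\<close> depends only on values along a short
  coordinate segment, which stays in \<open>S\<close> by openness. This allows derivative rules
  valid only on \<open>S\<close> to replace \<open>partial_deriv i f\<close>.\<close>

lemma Ck_on_cong:
  assumes S: "openin (Euclidean_space n) S" and "\<And>x. x \<in> S \<Longrightarrow> f x = g x"
  shows "Ck_on n k S f \<longleftrightarrow> Ck_on n k S g"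
  using assms(2)
proof (induction k arbitrary: f g)
  case 0
  then show ?case by (simp cong: continuous_on_cong)
next
  case (Suc k)
  have ev: "\<forall>\<^sub>F t in nhds (x i). f (x(i := t)) = g (x(i := t))" if "x \<in> S" "i < n" for x i
    using eventually_fun_upd_in[OF S that] by eventually_elim (rule Suc.prems)
  have diff: "(\<lambda>t. f (x(i := t))) field_differentiable at (x i) \<longleftrightarrow>
      (\<lambda>t. g (x(i := t))) field_differentiable at (x i)" if "x \<in> S" "i < n" for x i
    unfolding field_differentiable_def using DERIV_cong_ev[OF refl ev[OF that] refl] by simp
  have "partial_deriv i f x = partial_deriv i g x" if "x \<in> S" "i < n" for x i
    unfolding partial_deriv_def using ev[OF that] by (rule deriv_cong_ev) simp
  then have "Ck_on n k S (partial_deriv i f) \<longleftrightarrow> Ck_on n k S (partial_deriv i g)" if "i < n" for i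
    using that by (intro Suc.IH)
  moreover have "continuous_on S f \<longleftrightarrow> continuous_on S g"
    using Suc.prems by (simp cong: continuous_on_cong)
  ultimately show ?case using diff by auto
qed

lemma Ck_on_Suc_D: "Ck_on n (Suc k) S f \<Longrightarrow> Ck_on n k S f"
  by (induction k arbitrary: f) auto

lemma Ck_on_add:
  assumes S: "openin (Euclidean_space n) S"
  shows "Ck_on n k S f \<Longrightarrow> Ck_on n k S g \<Longrightarrow> Ck_on n k S (\<lambda>x. f x + g x)"
proof (induction k arbitrary: f g)
  case 0
  then show ?case by (simp add: continuous_on_add)
next
  case (Suc k)
  have "Ck_on n k S (partial_deriv i (\<lambda>x. f x + g x))" if "i < n" for i
  proof -
    have "Ck_on n k S (\<lambda>x. partial_deriv i f x + partial_deriv i g x)"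
      using Suc that by simp
    then show ?thesis
      using Suc.prems that by (subst Ck_on_cong[OF S]) (auto simp: partial_deriv_def)
  qed
  then show ?case
    using Suc.prems by (auto intro!: continuous_on_add field_differentiable_add)
qed

lemma Ck_on_mult:
  assumes S: "openin (Euclidean_space n) S"
  shows "Ck_on n k S f \<Longrightarrow> Ck_on n k S g \<Longrightarrow> Ck_on n k S (\<lambda>x. f x * g x)"
proof (induction k arbitrary: f g)
  case 0
  then show ?case by (simp add: continuous_on_mult)
next
  case (Suc k)
  have "Ck_on n k S (partial_deriv i (\<lambda>x. f x * g x))" if "i < n" for i
  proof -
    \<comment> \<open>The product rule pairs \<open>f\<close> and \<open>g\<close> with derivatives
      of order one less, so \<open>f\<close> and \<open>g\<close> themselves are lowered to order
      \<open>k\<close> before the induction hypothesis applies.\<close>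
    have "Ck_on n k S (\<lambda>x. f x * partial_deriv i g x + partial_deriv i f x * g x)"
      using Suc.prems that by (intro Ck_on_add[OF S] Suc.IH) (auto dest: Ck_on_Suc_D simp del: Ck_on.simps, auto)
    then show ?thesis
      using Suc.prems that by (subst Ck_on_cong[OF S]) (auto simp: partial_deriv_def)
  qed
  then show ?case
    using Suc.prems by (auto intro!: continuous_on_mult field_differentiable_mult)
qed

lemma Ck_on_const: "Ck_on n k S (\<lambda>_. c)"
proof (induction k arbitrary: c)
  case (Suc k)
  have "partial_deriv i (\<lambda>_. c) = (\<lambda>_. 0)" for i
    by (auto simp: partial_deriv_def)
  then show ?case using Suc by simp
qed simp

lemma chart_image_open:
  assumes "smooth_manifold M" "(V, \<phi>) \<in> atlas M"
  shows "openin (Euclidean_space (mdim M)) (\<phi> ` V)"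
  using assms by (auto simp: smooth_manifold_def is_chart_def)

lemma smooth_functions_add:
  assumes "smooth_manifold M" "f \<in> smooth_functions M" "g \<in> smooth_functions M"
  shows "f + g \<in> smooth_functions M"
  using assms chart_image_open[OF assms(1)] unfolding smooth_functions_def smooth_on_def
  by (auto intro!: Ck_on_add)

lemma smooth_functions_mult:
  assumes "smooth_manifold M" "f \<in> smooth_functions M" "g \<in> smooth_functions M"
  shows "f * g \<in> smooth_functions M"
  using assms chart_image_open[OF assms(1)] unfolding smooth_functions_def smooth_on_def
  by (auto intro!: Ck_on_mult)

lemma smooth_functions_scale:
  assumes "smooth_manifold M" "f \<in> smooth_functions M"
  shows "(\<lambda>p. c * f p) \<in> smooth_functions M"
  using assms chart_image_open[OF assms(1)] unfolding smooth_functions_def smooth_on_def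
  by (auto intro!: Ck_on_mult Ck_on_const)

text \<open>Smooth functions vanish off the manifold by convention, so a constant has to be cut off
  there. These functions later give real homogeneity of a connection in its first argument.\<close>

lemma smooth_functions_const:
  assumes "smooth_manifold M"
  shows "(\<lambda>p. if p \<in> points M then c else 0) \<in> smooth_functions M"
proof -
  have "Ck_on (mdim M) k (\<phi> ` V) (\<lambda>x. if inv_into V \<phi> x \<in> points M then c else 0)"
    if chart: "(V, \<phi>) \<in> atlas M" for V \<phi> k
  proof -
    have "V \<subseteq> points M"
      using assms chart by (auto simp: smooth_manifold_def)
    then show ?thesis
      using inv_into_into[of _ \<phi> V]
      by (subst Ck_on_cong[OF chart_image_open[OF assms chart], of _ "\<lambda>_. c"])
        (auto simp: Ck_on_const)
  qed
  then show ?thesis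
    by (auto simp: smooth_functions_def smooth_on_def)
qed

section \<open>Linear structure of tangent spaces and vector fields\<close>

lemma tangent_space_add:
  assumes "v \<in> tangent_space M p" "w \<in> tangent_space M p"
  shows "v + w \<in> tangent_space M p"
  using assms by (auto simp: tangent_space_def algebra_simps)

lemma tangent_space_scale:
  assumes "v \<in> tangent_space M p"
  shows "(\<lambda>f. c * v f) \<in> tangent_space M p"
  using assms by (auto simp: tangent_space_def algebra_simps)

lemma vector_field_tangent:
  "\<lbrakk>X \<in> vector_fields M; p \<in> points M\<rbrakk> \<Longrightarrow> X p \<in> tangent_space M p"
  by (simp add: vector_fields_def)

lemma vector_field_outside:
  "\<lbrakk>X \<in> vector_fields M; p \<notin> points M\<rbrakk> \<Longrightarrow> X p = 0"
  by (simp add: vector_fields_def)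

lemma vector_field_eqI:
  assumes "X \<in> vector_fields M" "Y \<in> vector_fields M" "\<And>p. p \<in> points M \<Longrightarrow> X p = Y p"
  shows "X = Y"
  using assms by (metis ext vector_field_outside)

lemma apply_vf_smooth:
  "\<lbrakk>X \<in> vector_fields M; f \<in> smooth_functions M\<rbrakk> \<Longrightarrow> apply_vf X f \<in> smooth_functions M"
  by (simp add: vector_fields_def apply_vf_def)

lemma vector_fields_add:
  assumes M: "smooth_manifold M" and "X \<in> vector_fields M" "Y \<in> vector_fields M"
  shows "X + Y \<in> vector_fields M"
proof -
  have "(\<lambda>p. (X + Y) p f) \<in> smooth_functions M" if "f \<in> smooth_functions M" for f
    using smooth_functions_add[OF M assms(2,3)[THEN apply_vf_smooth, OF that]]
    by (simp add: apply_vf_def plus_fun_def)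
  then show ?thesis
    using assms(2,3) by (simp add: vector_fields_def tangent_space_add)
qed

lemma vector_fields_scale:
  assumes M: "smooth_manifold M" and f: "f \<in> smooth_functions M" and X: "X \<in> vector_fields M"
  shows "scale_vf f X \<in> vector_fields M"
proof -
  have "(\<lambda>p. scale_vf f X p g) \<in> smooth_functions M" if "g \<in> smooth_functions M" for g
    using smooth_functions_mult[OF M f apply_vf_smooth[OF X that]]
    by (simp add: apply_vf_def scale_vf_def times_fun_def)
  then show ?thesis
    using X by (auto simp: vector_fields_def scale_vf_def tangent_space_scale zero_fun_def)
qed

text \<open>This is no instance of \<open>vector_fields_scale\<close>: the constant function need
  not vanish off the manifold.\<close>

lemma vector_fields_scale_const:
  assumes M: "smooth_manifold M" and X: "X \<in> vector_fields M"
  shows "scale_vf (\<lambda>_. c) X \<in> vector_fields M"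
proof -
  have "(\<lambda>p. scale_vf (\<lambda>_. c) X p g) \<in> smooth_functions M" if "g \<in> smooth_functions M" for g
    using smooth_functions_scale[OF M apply_vf_smooth[OF X that]]
    by (simp add: apply_vf_def scale_vf_def)
  then show ?thesis
    using X by (auto simp: vector_fields_def scale_vf_def tangent_space_scale zero_fun_def)
qed

lemma vector_fields_diff:
  assumes M: "smooth_manifold M" and X: "X \<in> vector_fields M" and Y: "Y \<in> vector_fields M"
  shows "X - Y \<in> vector_fields M"
proof -
  have "X - Y = X + scale_vf (\<lambda>_. - 1) Y"
    by (simp add: scale_vf_def fun_eq_iff)
  then show ?thesis
    using vector_fields_add[OF M X vector_fields_scale_const[OF M Y]] by metis
qed

section \<open>Commutative unital products on a carrier set, for tangent spaces and vector fields
  alike\<close>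

locale unital_product =
  fixes V :: "'a::ab_group_add set" and mult :: "'a \<Rightarrow> 'a \<Rightarrow> 'a" (infixl "\<star>" 70) and e :: 'a
  assumes add_closed [simp]: "\<lbrakk>x \<in> V; y \<in> V\<rbrakk> \<Longrightarrow> x + y \<in> V"
    and diff_closed [simp]: "\<lbrakk>x \<in> V; y \<in> V\<rbrakk> \<Longrightarrow> x - y \<in> V"
    and mult_closed [simp]: "\<lbrakk>x \<in> V; y \<in> V\<rbrakk> \<Longrightarrow> x \<star> y \<in> V"
    and unit_closed [simp]: "e \<in> V"
    and mult_commute: "\<lbrakk>x \<in> V; y \<in> V\<rbrakk> \<Longrightarrow> x \<star> y = y \<star> x"
    and mult_assoc: "\<lbrakk>x \<in> V; y \<in> V; z \<in> V\<rbrakk> \<Longrightarrow> x \<star> y \<star> z = x \<star> (y \<star> z)"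
    and mult_add_left: "\<lbrakk>x \<in> V; y \<in> V; z \<in> V\<rbrakk> \<Longrightarrow> (x + y) \<star> z = x \<star> z + y \<star> z"
    and mult_unit_left [simp]: "x \<in> V \<Longrightarrow> e \<star> x = x"
begin

lemma mult_unit_right [simp]: "x \<in> V \<Longrightarrow> x \<star> e = x"
  using mult_commute[of x e] by simp

lemma mult_left_commute: "\<lbrakk>x \<in> V; y \<in> V; z \<in> V\<rbrakk> \<Longrightarrow> x \<star> (y \<star> z) = y \<star> (x \<star> z)"
  by (metis mult_assoc mult_commute)

lemma mult_add_right: "\<lbrakk>x \<in> V; y \<in> V; z \<in> V\<rbrakk> \<Longrightarrow> x \<star> (y + z) = x \<star> y + x \<star> z"
  by (simp add: mult_add_left mult_commute[of x])

lemma zero_closed [simp]: "0 \<in> V"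
  using diff_closed[of e e] by simp

lemma uminus_closed [simp]: "x \<in> V \<Longrightarrow> - x \<in> V"
  using diff_closed[of 0 x] by simp

lemma mult_diff_left: "\<lbrakk>x \<in> V; y \<in> V; z \<in> V\<rbrakk> \<Longrightarrow> (x - y) \<star> z = x \<star> z - y \<star> z"
  using mult_add_left[of "x - y" y z] by (simp add: algebra_simps)

lemma mult_diff_right: "\<lbrakk>x \<in> V; y \<in> V; z \<in> V\<rbrakk> \<Longrightarrow> x \<star> (y - z) = x \<star> y - x \<star> z"
  by (simp add: mult_diff_left mult_commute[of x])

lemma mult_zero_left [simp]: "x \<in> V \<Longrightarrow> 0 \<star> x = 0"
  using mult_diff_left[of e e x] by simp

lemma mult_zero_right [simp]: "x \<in> V \<Longrightarrow> x \<star> 0 = 0"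
  using mult_commute[of x 0] by simp

lemma mult_minus_left: "\<lbrakk>x \<in> V; y \<in> V\<rbrakk> \<Longrightarrow> (- x) \<star> y = - (x \<star> y)"
  using mult_diff_left[of 0 x y] by simp

lemma mult_minus_right: "\<lbrakk>x \<in> V; y \<in> V\<rbrakk> \<Longrightarrow> x \<star> (- y) = - (x \<star> y)"
  using mult_diff_right[of x 0 y] by simp

lemmas mult_ac = mult_assoc mult_commute mult_left_commute
lemmas mult_distribs = mult_add_left mult_add_right mult_diff_left mult_diff_right
  mult_minus_left mult_minus_right

lemma cancel_inverse:
  assumes "E \<in> V" "F \<in> V" "E \<star> F = e" "x \<in> V"
  shows "E \<star> (F \<star> x) = x" "F \<star> (E \<star> x) = x"
  using assms by (metis mult_assoc mult_unit_left mult_commute)+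

text \<open>A derivation \<open>d\<close> of the dual product \<open>x \<star> y \<star> F\<close>
  fails to be one of the original product only by a term in \<open>d e\<close>. Taking
  \<open>x = e\<close> shows how \<open>d\<close> acts on multiples of \<open>F\<close>, and every
  element is such a multiple.\<close>

lemma dual_derivation_defect:
  assumes E: "E \<in> V" and F: "F \<in> V" and EF: "E \<star> F = e"
    and d: "\<And>x. x \<in> V \<Longrightarrow> d x \<in> V"
    and dual: "\<And>x y. \<lbrakk>x \<in> V; y \<in> V\<rbrakk> \<Longrightarrow>
      d (x \<star> y \<star> F) = d x \<star> y \<star> F + x \<star> d y \<star> F"
    and x: "x \<in> V" and y: "y \<in> V"
  shows "d (x \<star> y) - d x \<star> y - x \<star> d y = - (d e \<star> x \<star> y)"
proof -
  have dF: "d (a \<star> F) = d e \<star> a \<star> F + d a \<star> F" if "a \<in> V" for a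
    using dual[of e a] that by (simp add: d F)
  \<comment> \<open>With this choice \<open>y = z \<star> F\<close>, so \<open>x \<star> y\<close>
    is the dual product of \<open>x\<close> and \<open>z\<close>.\<close>
  define z where "z = E \<star> y"
  have z: "z \<in> V" "z \<star> F = y"
    using E F EF y by (simp_all add: z_def) (metis cancel_inverse(1) mult_assoc mult_commute)
  have "d (x \<star> y) = d x \<star> y + x \<star> (d z \<star> F)"
    using dual[OF x z(1)] x z d F by (simp add: mult_assoc)
  also have "d z \<star> F = d y - d e \<star> y"
    using dF[OF z(1)] z d F by (simp add: mult_assoc)
  finally show ?thesis
    using x y d by (simp add: mult_distribs mult_ac)
qed

end

section \<open>The dual of a compatible connection as pure algebra\<close>

locale compatible_connection = unital_product V mult e
  for V :: "'a::ab_group_add set" and mult (infixl "\<star>" 70) and e +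
  fixes D :: "'a \<Rightarrow> 'a \<Rightarrow> 'a" and lie :: "'a \<Rightarrow> 'a \<Rightarrow> 'a" and E F U :: 'a
  assumes D_closed [simp]: "\<lbrakk>x \<in> V; y \<in> V\<rbrakk> \<Longrightarrow> D x y \<in> V"
    and D_symmetric: "\<lbrakk>x \<in> V; y \<in> V; z \<in> V\<rbrakk> \<Longrightarrow>
      D x (y \<star> z) - D x y \<star> z - y \<star> D x z = D y (x \<star> z) - D y x \<star> z - x \<star> D y z"
    and D_unit: "x \<in> V \<Longrightarrow> D x e = U \<star> x"
    and lie_eq: "\<lbrakk>x \<in> V; y \<in> V\<rbrakk> \<Longrightarrow> lie x y = D x y - D y x"
    and E_closed [simp]: "E \<in> V" and F_closed [simp]: "F \<in> V" and U_closed [simp]: "U \<in> V"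
    and E_F: "E \<star> F = e"
    and lie_mult: "\<lbrakk>x \<in> V; y \<in> V; z \<in> V; w \<in> V\<rbrakk> \<Longrightarrow>
      lie (x \<star> y) (z \<star> w) - lie (x \<star> y) z \<star> w - z \<star> lie (x \<star> y) w =
        x \<star> (lie y (z \<star> w) - lie y z \<star> w - z \<star> lie y w) +
        y \<star> (lie x (z \<star> w) - lie x z \<star> w - z \<star> lie x w)"
    and lie_E_dual: "\<lbrakk>x \<in> V; y \<in> V\<rbrakk> \<Longrightarrow>
      lie E (x \<star> y \<star> F) = lie E x \<star> y \<star> F + x \<star> lie E y \<star> F"
begin

lemma lie_closed [simp]: "\<lbrakk>x \<in> V; y \<in> V\<rbrakk> \<Longrightarrow> lie x y \<in> V"
  by (simp add: lie_eq)

lemma F_E: "F \<star> E = e"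
  using E_F mult_commute[of E F] by simp

lemmas cancel = cancel_inverse[OF E_closed F_closed E_F]

lemma cancel_middle: "\<lbrakk>x \<in> V; y \<in> V\<rbrakk> \<Longrightarrow> F \<star> (x \<star> (E \<star> y)) = x \<star> y"
  using mult_left_commute[of F x "E \<star> y"] by (simp add: cancel)

lemma lie_E_mult:
  assumes "x \<in> V" "y \<in> V"
  shows "lie E (x \<star> y) = lie E x \<star> y + x \<star> lie E y - lie E e \<star> x \<star> y"
  using dual_derivation_defect[of E F "lie E" x y] lie_E_dual assms E_F
  by (simp add: algebra_simps)

lemma lie_self [simp]: "x \<in> V \<Longrightarrow> lie x x = 0"
  by (simp add: lie_eq)

text \<open>Apply \<open>lie_E_mult\<close> to \<open>E \<star> F = e\<close>, where
  \<open>lie E E = 0\<close>, and cancel \<open>E\<close>.\<close>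

lemma lie_E_F: "lie E F = F \<star> lie E e + F \<star> lie E e"
proof -
  have "lie E e = E \<star> lie E F - lie E e"
    using lie_E_mult[of E F] by (simp add: E_F mult_assoc)
  then have "E \<star> lie E F = lie E e + lie E e" by (simp add: algebra_simps)
  then have "F \<star> (E \<star> lie E F) = F \<star> (lie E e + lie E e)" by simp
  then show ?thesis by (simp add: cancel mult_distribs)
qed

text \<open>The locale has no scalars, so the factor two appears as a repeated summand; the factor
  1/2 of the dual connection will remove it.\<close>

lemma lie_F_E_mult:
  assumes "x \<in> V" "y \<in> V"
  shows "lie F E \<star> x \<star> y = - (F \<star> lie E e \<star> x \<star> y) + - (F \<star> lie E e \<star> x \<star> y)"
proof -
  have "lie F E = - lie E F"
    by (simp add: lie_eq)
  then show ?thesis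
    using assms by (simp add: lie_E_F mult_distribs)
qed

text \<open>The Lie derivative of the multiplication, evaluated at \<open>E\<close> and
  \<open>y\<close>, obeys a Leibniz rule in its direction. It vanishes in direction
  \<open>e = E \<star> F\<close>, so its value in direction \<open>E\<close> determines the one in
  direction \<open>F\<close>.\<close>

lemma lie_F_mult:
  assumes y: "y \<in> V"
  shows "lie F (E \<star> y) - lie F E \<star> y - E \<star> lie F y = F \<star> lie E e \<star> y"
proof -
  define L where "L x = lie x (E \<star> y) - lie x E \<star> y - E \<star> lie x y" for x
  have L: "L a \<in> V" if "a \<in> V" for a
    using that y by (simp add: L_def)
  have mult: "L (a \<star> b) = a \<star> L b + b \<star> L a" if "a \<in> V" "b \<in> V" for a b
    unfolding L_def using lie_mult[of a b E y] that y by simp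
  have "L e = 0"
    using mult[of e e] L by simp
  \<comment> \<open>This value is the derivation defect from \<open>lie_E_mult\<close>.\<close>
  moreover have "L E = - (E \<star> lie E e \<star> y)"
    using y by (simp add: L_def lie_E_mult mult_ac)
  ultimately have "E \<star> L F = F \<star> (E \<star> (lie E e \<star> y))"
    using mult[of E F] y L by (simp add: E_F mult_assoc mult_minus_right)
  then have "F \<star> (E \<star> L F) = F \<star> (lie E e \<star> y)"
    using y by (simp add: cancel)
  then show ?thesis
    using L y by (simp add: cancel mult_assoc) (simp add: L_def)
qed

text \<open>\<open>dual_D x y\<close> is the dual connection applied to \<open>x\<close> and \<open>E \<star> y\<close>: this substitution removes \<open>F\<close>
  from the computations. The term \<open>- lie E e\<close> comes from \<open>lie F E / 2 = - (F \<star> lie E e)\<close>.\<close>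

definition dual_D where
  "dual_D x y = E \<star> D x y - D y E \<star> x + (U \<star> F - lie E e) \<star> x \<star> y"

lemma dual_D_closed [simp]: "\<lbrakk>x \<in> V; y \<in> V\<rbrakk> \<Longrightarrow> dual_D x y \<in> V"
  by (simp add: dual_D_def)

text \<open>The bracket in the coefficient of \<open>dual_D\<close> turns \<open>D e E\<close> into
  \<open>D E e = U \<star> E\<close>, which cancels \<open>E \<star> D x e\<close>. What remains is
  the dual product of \<open>U\<close> and \<open>x\<close>.\<close>

lemma dual_D_unit:
  assumes "x \<in> V" shows "dual_D x e = U \<star> F \<star> x"
  using assms D_unit[of x] D_unit[of E] unfolding dual_D_def
  by (simp add: lie_eq mult_distribs mult_ac)

text \<open>The failure of torsion-freeness splits into asymmetries of \<open>C\<close> and of the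
  derivation defect of \<open>E\<close>, and both vanish. The term
  \<open>D E (E \<star> x \<star> y)\<close> occurs in two values of \<open>C\<close> and drops
  out.\<close>

lemma dual_D_torsion:
  assumes x: "x \<in> V" and y: "y \<in> V"
  shows "dual_D (E \<star> x) y - dual_D (E \<star> y) x = lie (E \<star> x) (E \<star> y)"
proof -
  define C where "C a b c = D a (b \<star> c) - D a b \<star> c - b \<star> D a c" for a b c
  have C: "C (E \<star> x) E y = C E (E \<star> x) y" "C (E \<star> y) E x = C E (E \<star> y) x"
    unfolding C_def using x y by (simp_all add: D_symmetric)
  \<comment> \<open>By \<open>lie_E_mult\<close> both sides equal
    \<open>- (lie E e \<star> E \<star> x \<star> y)\<close>.\<close>
  have T: "y \<star> (lie E (E \<star> x) - E \<star> lie E x) = x \<star> (lie E (E \<star> y) - E \<star> lie E y)"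
    using x y by (simp add: lie_E_mult mult_distribs mult_ac)
  have "dual_D (E \<star> x) y - dual_D (E \<star> y) x - lie (E \<star> x) (E \<star> y) =
     (C (E \<star> y) E x - C E (E \<star> y) x) - (C (E \<star> x) E y - C E (E \<star> x) y)
     + (y \<star> (lie E (E \<star> x) - E \<star> lie E x) - x \<star> (lie E (E \<star> y) - E \<star> lie E y))"
    using x y unfolding dual_D_def C_def
    by (simp add: lie_eq mult_distribs mult_ac)
  also have "\<dots> = 0"
    using C T by simp
  finally show ?thesis by simp
qed

text \<open>In the variables \<open>E \<star> x\<close>, \<open>E \<star> y\<close>,
  \<open>E \<star> z\<close> this is the symmetry of the covariant derivative of the dual
  multiplication. It is read off from a closed form that is visibly symmetric in the first two
  variables.\<close>

lemma dual_D_symmetric: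
  assumes x: "x \<in> V" and y: "y \<in> V" and z: "z \<in> V"
  shows "dual_D (E \<star> x) (y \<star> z) - dual_D (E \<star> x) y \<star> z - y \<star> dual_D (E \<star> x) z =
    dual_D (E \<star> y) (x \<star> z) - dual_D (E \<star> y) x \<star> z - x \<star> dual_D (E \<star> y) z"
proof -
  define C where "C a b c = D a (b \<star> c) - D a b \<star> c - b \<star> D a c" for a b c
  have sym: "C a b c = C b a c" if "a \<in> V" "b \<in> V" "c \<in> V" for a b c
    unfolding C_def using that by (simp add: D_symmetric)
  have comm: "C a b c = C a c b" if "a \<in> V" "b \<in> V" "c \<in> V" for a b c
    unfolding C_def using that by (simp add: mult_ac algebra_simps)
  \<comment> \<open>Every term on the right is symmetric in \<open>a\<close> and \<open>b\<close>.\<close>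
  have S: "dual_D (E \<star> a) (b \<star> z) - dual_D (E \<star> a) b \<star> z - b \<star> dual_D (E \<star> a) z =
      E \<star> (E \<star> C z a b) + E \<star> C z E (a \<star> b) + D z E \<star> E \<star> a \<star> b - (U \<star> F - lie E e) \<star> E \<star> a \<star> b \<star> z
      - lie E e \<star> E \<star> a \<star> b \<star> z + (lie E z + D E z) \<star> E \<star> a \<star> b
      + (D E a \<star> b + a \<star> D E b) \<star> E \<star> z
      - E \<star> (b \<star> D E (a \<star> z) + a \<star> D E (b \<star> z))"
    if a: "a \<in> V" and b: "b \<in> V" for a b
  proof -
    have 1: "C (E \<star> a) b z = C z (E \<star> a) b"
      using sym comm a b z by simp
    have 2: "C z E a = C E a z"
      using sym comm a z by simp
    have 3: "lie E (b \<star> z) = lie E b \<star> z + b \<star> lie E z - lie E e \<star> b \<star> z"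
      using lie_E_mult b z by simp
    \<comment> \<open>The difference of the two sides is the combination of facts 1, 2 and 3 with
      coefficients \<open>E\<close>, \<open>- (E \<star> b)\<close> and
      \<open>E \<star> a\<close>.\<close>
    have "dual_D (E \<star> a) (b \<star> z) - dual_D (E \<star> a) b \<star> z - b \<star> dual_D (E \<star> a) z
      - (E \<star> (E \<star> C z a b) + E \<star> C z E (a \<star> b) + D z E \<star> E \<star> a \<star> b - (U \<star> F - lie E e) \<star> E \<star> a \<star> b \<star> z
      - lie E e \<star> E \<star> a \<star> b \<star> z + (lie E z + D E z) \<star> E \<star> a \<star> b
      + (D E a \<star> b + a \<star> D E b) \<star> E \<star> z
      - E \<star> (b \<star> D E (a \<star> z) + a \<star> D E (b \<star> z))) =
      E \<star> (C (E \<star> a) b z - C z (E \<star> a) b) - E \<star> b \<star> (C z E a - C E a z)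
      + E \<star> a \<star> (lie E (b \<star> z) - (lie E b \<star> z + b \<star> lie E z - lie E e \<star> b \<star> z))"
      using a b z unfolding dual_D_def C_def
      by (simp add: lie_eq mult_distribs mult_ac)
    also have "\<dots> = 0"
      using 1 2 3 a b z by (simp add: C_def)
    finally show ?thesis by simp
  qed
  have C_closed: "C a b c \<in> V" if "a \<in> V" "b \<in> V" "c \<in> V" for a b c
    unfolding C_def using that by simp
  show ?thesis
    unfolding S[OF x y] S[OF y x] comm[OF z x y] mult_commute[OF x y]
    using x y z by (simp add: mult_distribs mult_ac C_closed add_ac)
qed

text \<open>The left side is the double dual connection applied to \<open>x\<close> and
  \<open>y\<close>, written in the original product. The only unknown term is
  \<open>D (E \<star> y) F\<close>, which compatibility and \<open>lie_F_mult\<close>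
  determine.\<close>

lemma dual_D_involution:
  assumes x: "x \<in> V" and y: "y \<in> V"
  shows "F \<star> dual_D x y - F \<star> x \<star> dual_D (E \<star> y) F + (U + F \<star> lie E e) \<star> x \<star> y = D x y"
proof -
  have 1: "D y e - D y F \<star> E - F \<star> D y E = D F (E \<star> y) - D F y \<star> E - y \<star> D F E"
    using D_symmetric[of y F E] y by (simp add: F_E mult_commute)
  have 2: "D F (E \<star> y) = D (E \<star> y) F + lie F E \<star> y + E \<star> lie F y + F \<star> lie E e \<star> y"
    using lie_F_mult[OF y] lie_eq[of F "E \<star> y"] y by (simp add: algebra_simps)
  have 3: "lie F E = - (F \<star> lie E e + F \<star> lie E e)"
    using lie_E_F by (simp add: lie_eq algebra_simps)
  \<comment> \<open>Fact 2 replaces \<open>D F (E \<star> y)\<close> in fact 1; the terms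
    \<open>E \<star> D y F\<close> and \<open>E \<star> D F y\<close> then cancel.\<close>
  have *: "D (E \<star> y) F = U \<star> y - F \<star> D y E + y \<star> D F E + F \<star> lie E e \<star> y"
    using 1 2 y by (simp add: 3 D_unit mult_distribs) (simp add: lie_eq mult_distribs mult_ac algebra_simps)
  have "F \<star> dual_D x y = D x y - F \<star> D y E \<star> x + (U \<star> F - lie E e) \<star> F \<star> x \<star> y"
    using x y unfolding dual_D_def by (simp add: mult_distribs cancel mult_assoc mult_commute mult_left_commute)
  moreover have "F \<star> dual_D (E \<star> y) F = D (E \<star> y) F - D F E \<star> y + (U \<star> F - lie E e) \<star> F \<star> y"
    using y unfolding dual_D_def by (simp add: mult_distribs cancel mult_assoc mult_commute mult_left_commute)
  moreover have "F \<star> x \<star> dual_D (E \<star> y) F = x \<star> (F \<star> dual_D (E \<star> y) F)"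
    using x y by (simp add: mult_assoc mult_left_commute)
  ultimately show ?thesis
    using x y by (simp add: * mult_distribs mult_ac)
qed

end

section \<open>The product of an F-manifold on fibres and on vector fields\<close>

lemma tangent_space_diff:
  assumes "v \<in> tangent_space M p" "w \<in> tangent_space M p"
  shows "v - w \<in> tangent_space M p"
  using assms by (auto simp: tangent_space_def algebra_simps)

text \<open>The fibrewise structure yields the laws for vector fields pointwise. It is also used
  directly where two multiplications are compared on single tangent vectors.\<close>

lemma F_manifold_fibre:
  assumes "F_manifold M m e" "p \<in> points M"
  shows "unital_product (tangent_space M p) (m p) (e p)"
proof -
  have mult: "m p v w \<in> tangent_space M p" "m p v w = m p w v"
      "m p (m p u v) w = m p u (m p v w)" "m p (u + v) w = m p u w + m p v w"
    if "u \<in> tangent_space M p" "v \<in> tangent_space M p" "w \<in> tangent_space M p" for u v w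
    using assms that unfolding F_manifold_def tangent_multiplication_def by blast+
  have unit: "e p \<in> tangent_space M p" "v \<in> tangent_space M p \<Longrightarrow> m p (e p) v = v" for v
    using assms by (simp_all add: F_manifold_def vector_field_tangent)
  show ?thesis
    by unfold_locales (rule mult unit tangent_space_add tangent_space_diff; assumption)+
qed

lemma F_manifold_mult_closed:
  "\<lbrakk>F_manifold M m e; X \<in> vector_fields M; Y \<in> vector_fields M\<rbrakk> \<Longrightarrow> X \<odot>\<^bsub>m\<^esub> Y \<in> vector_fields M"
  by (simp add: F_manifold_def tangent_multiplication_def)

lemma F_manifold_mult_outside:
  assumes "F_manifold M m e" "\<not> (p \<in> points M \<and> v \<in> tangent_space M p \<and> w \<in> tangent_space M p)"
  shows "m p v w = 0"
  using assms unfolding F_manifold_def tangent_multiplication_def by blast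

lemma F_manifold_mult_zero:
  assumes "F_manifold M m e"
  shows "m p 0 w = 0"
proof (cases "p \<in> points M \<and> w \<in> tangent_space M p")
  case True
  then show ?thesis
    using unital_product.mult_zero_left[OF F_manifold_fibre[OF assms]] by simp
next
  case False
  then show ?thesis
    by (intro F_manifold_mult_outside[OF assms]) auto
qed

lemma F_manifold_unit_closed: "F_manifold M m e \<Longrightarrow> e \<in> vector_fields M"
  by (simp add: F_manifold_def)

lemma F_manifold_unital_product:
  assumes m: "F_manifold M m e"
  shows "unital_product (vector_fields M) (\<lambda>X Y. X \<odot>\<^bsub>m\<^esub> Y) e"
proof -
  have M: "smooth_manifold M"
    using m by (simp add: F_manifold_def)
  note closed = vector_fields_add[OF M] vector_fields_diff[OF M] F_manifold_mult_closed[OF m]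
    F_manifold_unit_closed[OF m]
  show ?thesis
  proof
    fix X Y Z assume X: "X \<in> vector_fields M" and Y: "Y \<in> vector_fields M" and Z: "Z \<in> vector_fields M"
    note T = X[THEN vector_field_tangent] Y[THEN vector_field_tangent] Z[THEN vector_field_tangent]
    show "X \<odot>\<^bsub>m\<^esub> Y = Y \<odot>\<^bsub>m\<^esub> X"
    proof (rule vector_field_eqI)
      show "(X \<odot>\<^bsub>m\<^esub> Y) p = (Y \<odot>\<^bsub>m\<^esub> X) p" if "p \<in> points M" for p
        using unital_product.mult_commute[OF F_manifold_fibre[OF m that]] T[OF that]
        by (simp add: vf_mult_def)
    qed (use X Y closed in auto)
    show "X \<odot>\<^bsub>m\<^esub> Y \<odot>\<^bsub>m\<^esub> Z = X \<odot>\<^bsub>m\<^esub> (Y \<odot>\<^bsub>m\<^esub> Z)"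
    proof (rule vector_field_eqI)
      show "(X \<odot>\<^bsub>m\<^esub> Y \<odot>\<^bsub>m\<^esub> Z) p = (X \<odot>\<^bsub>m\<^esub> (Y \<odot>\<^bsub>m\<^esub> Z)) p" if "p \<in> points M" for p
        using unital_product.mult_assoc[OF F_manifold_fibre[OF m that]] T[OF that]
        by (simp add: vf_mult_def)
    qed (use X Y Z closed in auto)
    show "(X + Y) \<odot>\<^bsub>m\<^esub> Z = X \<odot>\<^bsub>m\<^esub> Z + Y \<odot>\<^bsub>m\<^esub> Z"
    proof (rule vector_field_eqI)
      show "((X + Y) \<odot>\<^bsub>m\<^esub> Z) p = (X \<odot>\<^bsub>m\<^esub> Z + Y \<odot>\<^bsub>m\<^esub> Z) p" if "p \<in> points M" for p
        using unital_product.mult_add_left[OF F_manifold_fibre[OF m that]] T[OF that]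
        by (simp add: vf_mult_def)
    qed (use X Y Z closed in auto)
    show "e \<odot>\<^bsub>m\<^esub> X = X"
    proof (rule vector_field_eqI)
      show "(e \<odot>\<^bsub>m\<^esub> X) p = X p" if "p \<in> points M" for p
        using unital_product.mult_unit_left[OF F_manifold_fibre[OF m that]] T[OF that]
        by (simp add: vf_mult_def)
    qed (use X closed in auto)
  qed (use closed in auto)
qed

lemma vf_inverse_eq:
  assumes "F_manifold M m e" "E \<in> vector_fields M" "F \<in> vector_fields M" "E \<odot>\<^bsub>m\<^esub> F = e"
  shows "vf_inverse M m e E = F"
proof -
  interpret unital_product "vector_fields M" "\<lambda>X Y. X \<odot>\<^bsub>m\<^esub> Y" e
    using assms(1) by (rule F_manifold_unital_product)
  show ?thesis
    unfolding vf_inverse_def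
  proof (rule the_equality)
    \<comment> \<open>Both are inverses of \<open>E\<close>, so
      \<open>F = F \<odot> (E \<odot> G) = G\<close>.\<close>
    show "G = F" if "G \<in> vector_fields M \<and> E \<odot>\<^bsub>m\<^esub> G = e" for G
      using that assms(2-4) cancel_inverse(2)[of E F G] by simp
  qed (use assms in auto)
qed

text \<open>At each point this is homogeneity under the real number \<open>f p\<close>, so one
  statement serves smooth functions and real constants.\<close>

lemma vf_mult_scale_left:
  assumes "F_manifold M m e" "X \<in> vector_fields M" "Y \<in> vector_fields M"
  shows "scale_vf f X \<odot>\<^bsub>m\<^esub> Y = scale_vf f (X \<odot>\<^bsub>m\<^esub> Y)"
proof
  fix p
  show "(scale_vf f X \<odot>\<^bsub>m\<^esub> Y) p = scale_vf f (X \<odot>\<^bsub>m\<^esub> Y) p"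
  proof (cases "p \<in> points M")
    case True
    with assms have "\<forall>c::real. m p (\<lambda>g. c * X p g) (Y p) = (\<lambda>g. c * m p (X p) (Y p) g)"
      by (simp add: F_manifold_def tangent_multiplication_def vector_field_tangent)
    then show ?thesis
      by (simp add: vf_mult_def scale_vf_def)
  next
    case False
    then have "m p v w = 0" for v w
      by (intro F_manifold_mult_outside[OF assms(1)]) auto
    then show ?thesis
      by (intro ext) (simp add: vf_mult_def scale_vf_def)
  qed
qed

lemma dual_mult_fields: "X \<odot>\<^bsub>dual_mult M m e E\<^esub> Y = X \<odot>\<^bsub>m\<^esub> Y \<odot>\<^bsub>m\<^esub> vf_inverse M m e E"
  by (simp add: vf_mult_def dual_mult_def)

lemma scale_vf_distribs:
  "scale_vf f (X + Y) = scale_vf f X + scale_vf f Y"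
  "scale_vf f (X - Y) = scale_vf f X - scale_vf f Y"
  by (simp_all add: scale_vf_def fun_eq_iff algebra_simps)

section \<open>A quadruple on a manifold, its dual and its double dual\<close>

locale quadruple =
  fixes M :: "'p manifold_data" and U :: "'p vfield"
    and m :: "'p tmult" and e E :: "'p vfield" and D :: "'p conn"
  assumes U: "U \<in> vector_fields M" and quadruple: "(m, e, E, D) \<in> quadruples M U"
begin

abbreviation "F \<equiv> vf_inverse M m e E"
abbreviation "s \<equiv> dual_mult M m e E"
abbreviation "dual_conn \<equiv> dual_connection M U m e E D"

lemma F_manifold: "F_manifold M m e" and F_manifold_dual: "F_manifold M s E"
  and conn: "connection M D" and E_field: "E \<in> vector_fields M"
  using quadruple by (simp_all add: quadruples_def eventual_identity_def)

lemma manifold: "smooth_manifold M"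
  using F_manifold by (simp add: F_manifold_def)

sublocale unital_product "vector_fields M" "\<lambda>X Y. X \<odot>\<^bsub>m\<^esub> Y" e
  using F_manifold by (rule F_manifold_unital_product)

lemma inverse: "F \<in> vector_fields M" "E \<odot>\<^bsub>m\<^esub> F = e"
proof -
  obtain G where G: "G \<in> vector_fields M" "E \<odot>\<^bsub>m\<^esub> G = e"
    using quadruple by (auto simp: quadruples_def eventual_identity_def vf_invertible_def)
  then have "F = G"
    using F_manifold E_field by (simp add: vf_inverse_eq)
  with G show "F \<in> vector_fields M" "E \<odot>\<^bsub>m\<^esub> F = e" by simp_all
qed

lemma bracket_eq:
  "\<lbrakk>X \<in> vector_fields M; Y \<in> vector_fields M\<rbrakk> \<Longrightarrow> lie_bracket X Y = D X Y - D Y X"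
  using quadruple by (simp add: quadruples_def torsion_free_def)

lemma D_fields_closed: "\<lbrakk>X \<in> vector_fields M; Y \<in> vector_fields M\<rbrakk> \<Longrightarrow> D X Y \<in> vector_fields M"
  using conn by (simp add: connection_def)

text \<open>Since \<open>E\<close> is the unit of \<open>s\<close>, the dual F-manifold identity in
  direction \<open>E = E \<odot> E\<close> reads \<open>L = L + L\<close>, where \<open>L\<close> is
  the Lie derivative of \<open>s\<close> along \<open>E\<close>. Hence \<open>L\<close>
  vanishes.\<close>

lemma lie_bracket_E_dual:
  assumes X: "X \<in> vector_fields M" and Y: "Y \<in> vector_fields M"
  shows "lie_bracket E (X \<odot>\<^bsub>m\<^esub> Y \<odot>\<^bsub>m\<^esub> F) =
    lie_bracket E X \<odot>\<^bsub>m\<^esub> Y \<odot>\<^bsub>m\<^esub> F + X \<odot>\<^bsub>m\<^esub> lie_bracket E Y \<odot>\<^bsub>m\<^esub> F"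
proof -
  interpret dual: unital_product "vector_fields M" "\<lambda>X Y. X \<odot>\<^bsub>s\<^esub> Y" E
    using F_manifold_dual by (rule F_manifold_unital_product)
  have "lie_deriv_mult s E X Y \<in> vector_fields M"
    using X Y by (simp add: lie_deriv_mult_def bracket_eq D_fields_closed)
  moreover have "lie_deriv_mult s (E \<odot>\<^bsub>s\<^esub> E) X Y =
      E \<odot>\<^bsub>s\<^esub> lie_deriv_mult s E X Y + E \<odot>\<^bsub>s\<^esub> lie_deriv_mult s E X Y"
    using F_manifold_dual X Y dual.unit_closed unfolding F_manifold_def by blast
  ultimately have "lie_deriv_mult s E X Y = 0"
    by simp
  then show ?thesis
    by (simp add: lie_deriv_mult_def dual_mult_fields algebra_simps)
qed

sublocale compatible_connection "vector_fields M" "\<lambda>X Y. X \<odot>\<^bsub>m\<^esub> Y" e D lie_bracket E F U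
proof
  fix X Y Z W
  assume X: "X \<in> vector_fields M" and Y: "Y \<in> vector_fields M" and Z: "Z \<in> vector_fields M"
    and W: "W \<in> vector_fields M"
  show "D X (Y \<odot>\<^bsub>m\<^esub> Z) - D X Y \<odot>\<^bsub>m\<^esub> Z - Y \<odot>\<^bsub>m\<^esub> D X Z =
      D Y (X \<odot>\<^bsub>m\<^esub> Z) - D Y X \<odot>\<^bsub>m\<^esub> Z - X \<odot>\<^bsub>m\<^esub> D Y Z"
    using quadruple X Y Z by (simp add: quadruples_def compatible_def cov_deriv_mult_def)
  show "lie_bracket (X \<odot>\<^bsub>m\<^esub> Y) (Z \<odot>\<^bsub>m\<^esub> W) - lie_bracket (X \<odot>\<^bsub>m\<^esub> Y) Z \<odot>\<^bsub>m\<^esub> W -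
      Z \<odot>\<^bsub>m\<^esub> lie_bracket (X \<odot>\<^bsub>m\<^esub> Y) W =
      X \<odot>\<^bsub>m\<^esub> (lie_bracket Y (Z \<odot>\<^bsub>m\<^esub> W) - lie_bracket Y Z \<odot>\<^bsub>m\<^esub> W - Z \<odot>\<^bsub>m\<^esub> lie_bracket Y W) +
      Y \<odot>\<^bsub>m\<^esub> (lie_bracket X (Z \<odot>\<^bsub>m\<^esub> W) - lie_bracket X Z \<odot>\<^bsub>m\<^esub> W - Z \<odot>\<^bsub>m\<^esub> lie_bracket X W)"
    using F_manifold X Y Z W by (simp add: F_manifold_def lie_deriv_mult_def)
  show "D X e = U \<odot>\<^bsub>m\<^esub> X"
    using quadruple X by (simp add: quadruples_def)
qed (use D_fields_closed bracket_eq lie_bracket_E_dual inverse E_field U in auto)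

text \<open>The dual product of \<open>e\<close> with the square of \<open>E\<close> is that square
  times \<open>F\<close>, which is \<open>E\<close>, the unit of \<open>s\<close>.\<close>

lemma inverse_dual: "vf_inverse M s E e = E \<odot>\<^bsub>m\<^esub> E"
  by (rule vf_inverse_eq[OF F_manifold_dual]) (simp_all add: dual_mult_fields mult_assoc E_F)

lemma dual_mult_involution: "dual_mult M s E e = m"
proof (intro ext)
  fix p v w g
  show "dual_mult M s E e p v w g = m p v w g"
  proof (cases "p \<in> points M \<and> v \<in> tangent_space M p \<and> w \<in> tangent_space M p")
    case True
    interpret fibre: unital_product "tangent_space M p" "m p" "e p"
      using F_manifold True by (simp add: F_manifold_fibre)
    have T: "E p \<in> tangent_space M p" "F p \<in> tangent_space M p"
      using True by (simp_all add: vector_field_tangent)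
    have EF: "m p (E p) (F p) = e p"
      using E_F by (simp add: vf_mult_def fun_eq_iff)
    \<comment> \<open>With \<open>a = m p v w\<close> this is the double dual product: each passage
      to the dual contributes one \<open>F\<close>, and the inverse of \<open>e\<close> in
      \<open>s\<close> contributes both factors \<open>E\<close>.\<close>
    have "m p (m p (m p a (F p)) (m p (E p) (E p))) (F p) = a" if a: "a \<in> tangent_space M p" for a
    proof -
      have "m p (m p (m p a (F p)) (m p (E p) (E p))) (F p) =
          m p (E p) (m p (F p) (m p (E p) (m p (F p) a)))"
        using T a by (simp add: fibre.mult_ac)
      then show ?thesis
        using a T by (simp add: fibre.cancel_inverse[OF T EF])
    qed
    then show ?thesis
      using True by (simp add: dual_mult_def[of M s] inverse_dual) (simp add: dual_mult_def vf_mult_def)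
  next
    case False
    \<comment> \<open>Off the domain the inner dual product is 0, and multiplying 0 by anything
      gives 0.\<close>
    then show ?thesis
      by (simp add: dual_mult_def[of M s] F_manifold_mult_outside[OF F_manifold_dual]
          F_manifold_mult_outside[OF F_manifold] F_manifold_mult_zero[OF F_manifold_dual])
  qed
qed

lemma dual_conn_eq:
  assumes X: "X \<in> vector_fields M" and Y: "Y \<in> vector_fields M"
  shows "dual_conn X Y = dual_D X (F \<odot>\<^bsub>m\<^esub> Y)"
proof -
  \<comment> \<open>\<open>lie_F_E_mult\<close> gives the bracket term exactly this doubled
    form.\<close>
  have "scale_vf (\<lambda>_. 1/2) (Z + Z) = Z" for Z :: "'p vfield"
    by (simp add: scale_vf_def fun_eq_iff)
  then have half: "scale_vf (\<lambda>_. 1/2) (lie_bracket F E \<odot>\<^bsub>m\<^esub> X \<odot>\<^bsub>m\<^esub> Y) =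
      - (F \<odot>\<^bsub>m\<^esub> lie_bracket E e \<odot>\<^bsub>m\<^esub> X \<odot>\<^bsub>m\<^esub> Y)"
    unfolding lie_F_E_mult[OF X Y] .
  show ?thesis
    using X Y unfolding dual_connection_def Let_def half
    by (simp add: dual_mult_fields dual_D_def mult_distribs mult_ac)
qed

lemma dual_conn_E:
  "\<lbrakk>X \<in> vector_fields M; Y \<in> vector_fields M\<rbrakk> \<Longrightarrow> dual_conn X (E \<odot>\<^bsub>m\<^esub> Y) = dual_D X Y"
  by (simp add: dual_conn_eq cancel)

lemmas scale_left = vf_mult_scale_left[OF F_manifold]

lemma scale_right:
  assumes "X \<in> vector_fields M" "Y \<in> vector_fields M" "scale_vf f Y \<in> vector_fields M"
  shows "X \<odot>\<^bsub>m\<^esub> scale_vf f Y = scale_vf f (X \<odot>\<^bsub>m\<^esub> Y)"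
  using assms by (simp add: mult_commute[of X] scale_left)

lemma dual_conn_connection: "connection M dual_conn"
proof -
  have add_left: "D (X + X') Y = D X Y + D X' Y"
    and scale_vf_left: "f \<in> smooth_functions M \<Longrightarrow> D (scale_vf f X) Y = scale_vf f (D X Y)"
    and add_right: "D X (Y + Y') = D X Y + D X Y'"
    and const_right: "D X (scale_vf (\<lambda>_. c) Y) = scale_vf (\<lambda>_. c) (D X Y)"
    and leibniz: "f \<in> smooth_functions M \<Longrightarrow>
      D X (scale_vf f Y) = scale_vf (apply_vf X f) Y + scale_vf f (D X Y)"
    if "X \<in> vector_fields M" "Y \<in> vector_fields M" "X' \<in> vector_fields M" "Y' \<in> vector_fields M"
    for X Y X' Y' f c
    using conn that by (simp_all add: connection_def)
  \<comment> \<open>The term \<open>D (F \<odot> Y) E\<close> of the dual connection puts its second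
    argument into the first slot of \<open>D\<close>, so real homogeneity is required there. The
    cut-off constant is smooth and scales a field in the same way, as fields vanish off the
    manifold.\<close>
  have const_left: "D (scale_vf (\<lambda>_. c) X) Y = scale_vf (\<lambda>_. c) (D X Y)"
    if X: "X \<in> vector_fields M" and Y: "Y \<in> vector_fields M" for X Y c
  proof -
    have "scale_vf (\<lambda>_. c) Z = scale_vf (\<lambda>p. if p \<in> points M then c else 0) Z"
      if "Z \<in> vector_fields M" for Z
      using that by (auto simp: scale_vf_def fun_eq_iff vector_field_outside)
    then show ?thesis
      using X Y scale_vf_left[of X Y X Y] smooth_functions_const[OF manifold] by simp
  qed
  show ?thesis
    unfolding connection_def
  proof (intro conjI ballI allI impI)
    fix X Y assume X: "X \<in> vector_fields M" and Y: "Y \<in> vector_fields M"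
    show "dual_conn X Y \<in> vector_fields M"
      using X Y by (simp add: dual_conn_eq)
    show "dual_conn (X + X') Y = dual_conn X Y + dual_conn X' Y" if "X' \<in> vector_fields M" for X'
      using X Y that by (simp add: dual_conn_eq dual_D_def add_left[of _ _ _ X] mult_distribs)
    show "dual_conn X (Y + Y') = dual_conn X Y + dual_conn X Y'" if "Y' \<in> vector_fields M" for Y'
      using X Y that
      by (simp add: dual_conn_eq dual_D_def add_left[of _ _ _ X] add_right[of _ _ X] mult_distribs)
    show "dual_conn (scale_vf f X) Y = scale_vf f (dual_conn X Y)" if f: "f \<in> smooth_functions M" for f
    proof -
      have "scale_vf f Z \<in> vector_fields M" if "Z \<in> vector_fields M" for Z
        using manifold f that by (rule vector_fields_scale)
      then show ?thesis
        using X Y f by (simp add: dual_conn_eq dual_D_def scale_vf_left[of _ _ X X]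
            scale_left scale_right scale_vf_distribs)
    qed
    show "dual_conn X (scale_vf (\<lambda>_. c) Y) = scale_vf (\<lambda>_. c) (dual_conn X Y)" for c
      using X Y by (simp add: dual_conn_eq dual_D_def const_right[of _ _ X X] const_left
          vector_fields_scale_const[OF manifold] scale_left scale_right scale_vf_distribs)
    show "dual_conn X (scale_vf f Y) = scale_vf (apply_vf X f) Y + scale_vf f (dual_conn X Y)"
      if f: "f \<in> smooth_functions M" for f
    proof -
      have closed: "scale_vf g Z \<in> vector_fields M" if "Z \<in> vector_fields M" "g \<in> smooth_functions M" for g Z
        using manifold that(2,1) by (rule vector_fields_scale)
      show ?thesis
        \<comment> \<open>The derivative of \<open>f\<close> arises only from
          \<open>E \<odot> D X (F \<odot> Y)\<close>, where it multiplies
          \<open>E \<odot> (F \<odot> Y) = Y\<close>. All other terms are linear over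
          functions.\<close>
        using X Y f apply_vf_smooth[OF X f]
        by (simp add: dual_conn_eq dual_D_def scale_vf_left[of _ _ X X] leibniz[of _ _ X X] closed
            scale_left scale_right scale_vf_distribs mult_distribs cancel)
    qed
  qed (auto simp: dual_connection_def)
qed

lemma dual_quadruple: "(s, E, e, dual_conn) \<in> quadruples M U"
proof -
  have "vf_invertible M s E e"
    unfolding vf_invertible_def
    by (rule bexI[of _ "E \<odot>\<^bsub>m\<^esub> E"]) (simp_all add: dual_mult_fields mult_assoc E_F)
  then have "eventual_identity M s E e"
    using F_manifold by (simp add: eventual_identity_def dual_mult_involution)
  moreover have "torsion_free M dual_conn"
    unfolding torsion_free_def
  proof (intro ballI)
    fix X Y assume X: "X \<in> vector_fields M" and Y: "Y \<in> vector_fields M"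
    then show "dual_conn X Y - dual_conn Y X = lie_bracket X Y"
      using dual_D_torsion[of "F \<odot>\<^bsub>m\<^esub> X" "F \<odot>\<^bsub>m\<^esub> Y"] by (simp add: dual_conn_eq cancel)
  qed
  moreover have "compatible M dual_conn s"
  proof -
    \<comment> \<open>The dual product of \<open>Y\<close> and \<open>Z\<close>, times
      \<open>F\<close>, is the original product of \<open>F \<odot> Y\<close> and
      \<open>F \<odot> Z\<close>. This brings the covariant derivative to the form treated in
      \<open>dual_D_symmetric\<close>.\<close>
    have cov: "cov_deriv_mult dual_conn s X Y Z =
        dual_D X (F \<odot>\<^bsub>m\<^esub> Y \<odot>\<^bsub>m\<^esub> (F \<odot>\<^bsub>m\<^esub> Z)) - dual_D X (F \<odot>\<^bsub>m\<^esub> Y) \<odot>\<^bsub>m\<^esub> (F \<odot>\<^bsub>m\<^esub> Z) -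
        F \<odot>\<^bsub>m\<^esub> Y \<odot>\<^bsub>m\<^esub> dual_D X (F \<odot>\<^bsub>m\<^esub> Z)"
      if "X \<in> vector_fields M" "Y \<in> vector_fields M" "Z \<in> vector_fields M" for X Y Z
      using that by (simp add: cov_deriv_mult_def dual_mult_fields dual_conn_eq mult_ac)
    show ?thesis
      unfolding compatible_def
    proof (intro ballI conjI)
      fix X Y Z
      assume X: "X \<in> vector_fields M" and Y: "Y \<in> vector_fields M" and Z: "Z \<in> vector_fields M"
      then show "cov_deriv_mult dual_conn s X Y Z = cov_deriv_mult dual_conn s Y X Z"
        using dual_D_symmetric[of "F \<odot>\<^bsub>m\<^esub> X" "F \<odot>\<^bsub>m\<^esub> Y" "F \<odot>\<^bsub>m\<^esub> Z"] by (simp add: cov cancel)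
      show "cov_deriv_mult dual_conn s X Y Z = cov_deriv_mult dual_conn s X Z Y"
        using X Y Z by (simp add: cov mult_ac algebra_simps)
    qed
  qed
  moreover have "dual_conn X E = U \<odot>\<^bsub>s\<^esub> X" if "X \<in> vector_fields M" for X
    using that dual_D_unit[OF that] by (simp add: dual_conn_eq F_E dual_mult_fields mult_ac)
  ultimately show ?thesis
    using F_manifold_dual dual_conn_connection by (simp add: quadruples_def)
qed

lemma dual_connection_involution: "dual_connection M U s E e dual_conn = D"
proof (intro ext)
  \<comment> \<open>The dual quadruple satisfies the same axioms, so \<open>dual_conn_eq\<close>
    also describes the double dual, with \<open>e\<close> and \<open>E\<close> exchanged.\<close>
  interpret dual: quadruple M U s E e dual_conn
    using U dual_quadruple by unfold_locales
  fix X Y p f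
  show "dual_connection M U s E e dual_conn X Y p f = D X Y p f"
  proof (cases "X \<in> vector_fields M \<and> Y \<in> vector_fields M")
    case True
    then have X: "X \<in> vector_fields M" and Y: "Y \<in> vector_fields M" by auto
    have "vf_inverse M s E e \<odot>\<^bsub>s\<^esub> Y = E \<odot>\<^bsub>m\<^esub> Y"
      using Y by (simp add: inverse_dual dual_mult_fields mult_assoc mult_commute[of _ F] cancel)
    then have "dual_connection M U s E e dual_conn X Y = dual.dual_D X (E \<odot>\<^bsub>m\<^esub> Y)"
      using X Y by (simp add: dual.dual_conn_eq)
    also have "\<dots> = F \<odot>\<^bsub>m\<^esub> dual_D X Y - F \<odot>\<^bsub>m\<^esub> X \<odot>\<^bsub>m\<^esub> dual_D (E \<odot>\<^bsub>m\<^esub> Y) F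
        + (U + F \<odot>\<^bsub>m\<^esub> lie_bracket E e) \<odot>\<^bsub>m\<^esub> X \<odot>\<^bsub>m\<^esub> Y"
    proof -
      have 1: "dual_conn X (E \<odot>\<^bsub>m\<^esub> Y) = dual_D X Y"
        using X Y by (rule dual_conn_E)
      have 2: "dual_conn (E \<odot>\<^bsub>m\<^esub> Y) e = dual_D (E \<odot>\<^bsub>m\<^esub> Y) F"
        using Y by (simp add: dual_conn_eq)
      \<comment> \<open>This is the coefficient in the definition of \<open>dual.dual_D\<close>. The
        factor \<open>E\<close> split off here is absorbed by the dual products in fact 4.\<close>
      have 3: "U \<odot>\<^bsub>s\<^esub> vf_inverse M s E e - lie_bracket e E = E \<odot>\<^bsub>m\<^esub> (U + F \<odot>\<^bsub>m\<^esub> lie_bracket E e)"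
        by (simp add: inverse_dual dual_mult_fields mult_distribs cancel mult_assoc E_F)
          (simp add: lie_eq mult_commute)
      define K where "K = U + F \<odot>\<^bsub>m\<^esub> lie_bracket E e"
      have K: "K \<in> vector_fields M"
        by (simp add: K_def)
      have 4: "E \<odot>\<^bsub>m\<^esub> K \<odot>\<^bsub>s\<^esub> X \<odot>\<^bsub>s\<^esub> (E \<odot>\<^bsub>m\<^esub> Y) = K \<odot>\<^bsub>m\<^esub> X \<odot>\<^bsub>m\<^esub> Y"
        using X Y K cancel_middle[of "K \<odot>\<^bsub>m\<^esub> X" Y]
        by (simp add: dual_mult_fields mult_assoc mult_commute[of _ F] cancel)
      show ?thesis
        \<comment> \<open>A dual product with \<open>e\<close> is multiplication by
          \<open>F\<close>, which accounts for the \<open>F\<close> in the first term of the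
          target.\<close>
        unfolding dual.dual_D_def 1 2 3 K_def[symmetric] 4
        using X Y by (simp add: dual_mult_fields mult_ac)
    qed
    also have "\<dots> = D X Y"
      using X Y by (rule dual_D_involution)
    finally show ?thesis by simp
  next
    case False
    \<comment> \<open>Connections are 0 on arguments that are not vector fields, so the equality
      holds for the functions \<open>D\<close> as a whole.\<close>
    moreover from this have "D X Y = 0"
      using conn unfolding connection_def by blast
    ultimately show ?thesis
      by (auto simp: dual_connection_def)
  qed
qed

end

theorem proposition22:
  fixes M :: "'p manifold_data" and U :: "'p vfield"
  assumes "smooth_manifold M" and "U \<in> vector_fields M"
  shows "involution_on (quadruples M U) (duality_map M U)"
  unfolding involution_on_def
proof
  fix x assume x: "x \<in> quadruples M U"
  obtain m e E D where eq: "x = (m, e, E, D)"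
    by (cases x)
  interpret quadruple M U m e E D
    using assms(2) x by unfold_locales (simp_all add: eq)
  show "duality_map M U x \<in> quadruples M U \<and> duality_map M U (duality_map M U x) = x"
    by (simp add: eq duality_map_def dual_quadruple dual_mult_involution dual_connection_involution)
qed

end
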